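(* Let $t\ge 0$ be an integer and let $T$ be a doubly-regular tournament of order $4t+3$. Then every arc of $T$ lies on exactly $2(t+1)(t-1)t^{2}(16t^{2}-4t-11)$ cycles of length $8$ in $T$.
   Context: A tournament of order $n$ is an orientation of the complete graph $K_n$; write $i\to j$ if $(i,j)$ is an arc. The out-set $N^{+}(i)$ (resp. in-set $N^{-}(i)$) of a vertex $i$ is the set of vertices dominated by $i$ (resp. dominating $i$), and is also used to denote the subtournament it induces. A tournament is regular if every vertex has out-degree (and hence in-degree) $\delta=\frac{n-1}{2}$. A doubly-regular tournament of order $n$ is a regular tournament in which, for every vertex $i$, both $N^{+}(i)$ and $N^{-}(i)$ induce regular tournaments of order $\delta$ (such tournaments exist only for $n\equiv 3 \pmod 4$). A cycle of length $m$ ($m$-cycle) is a directed cycle through $m$ distinct vertices, counted as a subgraph (not with a distinguished starting point). *)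

theory Defs
  imports "Graph_Theory.Graph_Theory"
begin

locale tournament = digraph T for T :: "('a, 'b) pre_digraph" (structure) +
  assumes exactly_one_dominates:
    "u \<in> verts T \<Longrightarrow> v \<in> verts T \<Longrightarrow> u \<noteq> v \<Longrightarrow> (u \<rightarrow>\<^bsub>T\<^esub> v) \<noteq> (v \<rightarrow>\<^bsub>T\<^esub> u)"

definition out_set :: "('a, 'b) pre_digraph \<Rightarrow> 'a \<Rightarrow> 'a set" where
  "out_set G i = {j. i \<rightarrow>\<^bsub>G\<^esub> j}"

definition in_set :: "('a, 'b) pre_digraph \<Rightarrow> 'a \<Rightarrow> 'a set" where
  "in_set G i = {j. j \<rightarrow>\<^bsub>G\<^esub> i}"

text \<open>Out-degree \<open>(n - 1) / 2\<close>, written without division or subtraction on \<^typ>\<open>nat\<close>.\<close>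

locale regular_tournament = tournament T for T :: "('a, 'b) pre_digraph" (structure) +
  assumes out_degree_regular: "v \<in> verts T \<Longrightarrow> 2 * out_degree T v + 1 = card (verts T)"

text \<open>
  The subtournaments have order \<open>(n - 1) / 2\<close> automatically: there are no parallel arcs,
  so \<^term>\<open>out_set T v\<close> has \<^term>\<open>out_degree T v\<close> elements, and dually for
  \<^term>\<open>in_set T v\<close>.
\<close>

locale doubly_regular_tournament = regular_tournament T
  for T :: "('a, 'b) pre_digraph" (structure) +
  assumes out_set_regular: "v \<in> verts T \<Longrightarrow> regular_tournament (T \<restriction> out_set T v)"
    and in_set_regular: "v \<in> verts T \<Longrightarrow> regular_tournament (T \<restriction> in_set T v)"

text \<open>
  The digraph \<open>C\<close> is itself a directed cycle of length \<open>m\<close>. The closed walk \<open>p\<close> (a list of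
  arcs) records a starting point, but \<open>C\<close> does not. The vertices visited by \<open>p\<close> are
  the tails of its arcs.
\<close>

definition is_cycle_digraph :: "nat \<Rightarrow> ('a, 'b) pre_digraph \<Rightarrow> bool" where
  "is_cycle_digraph m C \<longleftrightarrow>
     (\<exists>p. pre_digraph.cycle C p \<and> length p = m \<and> arcs C = set p \<and> verts C = tail C ` set p)"

text \<open>
  Since \<^term>\<open>subgraph C G\<close> forces \<open>C\<close> to have the same \<^const>\<open>tail\<close> and \<^const>\<open>head\<close> functions
  as \<open>G\<close>, distinct elements have distinct vertex or arc sets.
\<close>

definition cycle_subgraphs :: "('a, 'b) pre_digraph \<Rightarrow> nat \<Rightarrow> ('a, 'b) pre_digraph set" where
  "cycle_subgraphs G m = {C. subgraph C G \<and> is_cycle_digraph m C}"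

lemma (in fin_digraph) finite_cycle_subgraphs: "finite (cycle_subgraphs G m)"
proof (rule finite_subset)
  show "cycle_subgraphs G m \<subseteq>
    (\<lambda>(V, A). \<lparr> verts = V, arcs = A, tail = tail G, head = head G \<rparr>) ` (Pow (verts G) \<times> Pow (arcs G))"
  proof
    fix C assume "C \<in> cycle_subgraphs G m"
    then have "verts C \<subseteq> verts G" "arcs C \<subseteq> arcs G" "tail C = tail G" "head C = head G"
      by (auto simp: cycle_subgraphs_def subgraph_def compatible_def)
    then show "C \<in> (\<lambda>(V, A). \<lparr> verts = V, arcs = A, tail = tail G, head = head G \<rparr>) `
        (Pow (verts G) \<times> Pow (arcs G))"
      by (intro image_eqI[where x = "(verts C, arcs C)"]) auto
  qed
qed simp

end

theory Submission
  imports Defs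
begin

text \<open>
  Write \<open>A\<close> for the adjacency matrix. Double regularity gives
  \<open>A\<^sup>2 = t A + (t + 1) A\<^sup>T\<close> and \<open>A A\<^sup>T = A\<^sup>T A = (t + 1) I + t J\<close>, so the span of
  \<open>I, A, A\<^sup>T\<close> is closed under matrix multiplication as well as entrywise multiplication.
  An 8-cycle through the arc \<open>x\<^sub>0 \<rightarrow> x\<^sub>1\<close> is a choice of \<open>x\<^sub>2, \<dots>, x\<^sub>7\<close> subject to the arcs
  \<open>x\<^sub>i \<rightarrow> x\<^sub>i\<^sub>+\<^sub>1\<close> and to inequations \<open>x\<^sub>i \<noteq> x\<^sub>j\<close>. Expanding the inequations as
  \<open>1 - [x\<^sub>i = x\<^sub>j]\<close> identifies some of the vertices; each resulting constraint network either
  contains a 2-cycle or is series-parallel, and then it is contracted to a single matrix in the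
  span by the two products. The many terms are summed by a verified evaluator whose numbers are
  polynomials in \<open>t\<close>.
\<close>

section \<open>Constraint networks\<close>

text \<open>
  An \<open>ipoly\<close> lists the coefficients of a polynomial in \<open>t\<close>, constant term first. The weight
  \<open>(p, q, r)\<close> stands for the matrix \<open>p I + q A + r A\<^sup>T\<close>, and an entry \<open>(i, j, w)\<close> of a network
  for the factor \<open>w(x\<^sub>i, x\<^sub>j)\<close>.
\<close>

type_synonym ipoly = "int list"
type_synonym weight = "ipoly \<times> ipoly \<times> ipoly"
type_synonym network = "(nat \<times> nat \<times> weight) list"

text \<open>
  Dropping trailing zeros lets the evaluator recognise the zero polynomial and equal polynomials
  syntactically; soundness does not depend on it.
\<close>

definition pcons :: "int \<Rightarrow> ipoly \<Rightarrow> ipoly" where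
  "pcons a p = (if a = 0 \<and> p = [] then [] else a # p)"

fun padd :: "ipoly \<Rightarrow> ipoly \<Rightarrow> ipoly" where
  "padd [] q = q"
| "padd p [] = p"
| "padd (a # p) (b # q) = pcons (a + b) (padd p q)"

definition psmult :: "int \<Rightarrow> ipoly \<Rightarrow> ipoly" where
  "psmult a p = foldr (\<lambda>b. pcons (a * b)) p []"

primrec pmult :: "ipoly \<Rightarrow> ipoly \<Rightarrow> ipoly" where
  "pmult [] q = []"
| "pmult (a # p) q = padd (psmult a q) (pcons 0 (pmult p q))"

primrec ipoly_val :: "int \<Rightarrow> ipoly \<Rightarrow> int" where
  "ipoly_val x [] = 0"
| "ipoly_val x (a # p) = a + x * ipoly_val x p"

section \<open>Operations on weights and networks\<close>

fun transpose_weight :: "weight \<Rightarrow> weight" where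
  "transpose_weight (p, q, r) = (p, r, q)"

fun pointwise_weight :: "weight \<Rightarrow> weight \<Rightarrow> weight" where
  "pointwise_weight (p, q, r) (p', q', r') = (pmult p p', pmult q q', pmult r r')"

text \<open>The matrix product. \<open>m\<close> is the coefficient of
  \<open>A A\<^sup>T = A\<^sup>T A = (2t + 1) I + t A + t A\<^sup>T\<close>; the literals
  \<open>[1, 2]\<close>, \<open>[0, 1]\<close>, \<open>[1, 1]\<close> are \<open>2t + 1\<close>,
  \<open>t\<close>, \<open>t + 1\<close>.\<close>

fun compose_weight :: "weight \<Rightarrow> weight \<Rightarrow> weight" where
  "compose_weight (p, q, r) (p', q', r') =
    (let m = padd (pmult q r') (pmult r q') in
     (padd (pmult p p') (pmult [1, 2] m),
      padd (padd (pmult p q') (pmult q p'))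
        (padd (pmult [0, 1] (padd m (pmult q q'))) (pmult [1, 1] (pmult r r'))),
      padd (padd (pmult p r') (pmult r p'))
        (padd (pmult [0, 1] (padd m (pmult r r'))) (pmult [1, 1] (pmult q q')))))"

text \<open>Parallel edges merge by the entrywise product. A new edge runs from the smaller to the
  larger index, so that the last edge has the form \<open>(0, 1, w)\<close> which
  \<open>evaluate\<close> expects.\<close>

fun add_edge :: "nat \<Rightarrow> nat \<Rightarrow> weight \<Rightarrow> network \<Rightarrow> network" where
  "add_edge i j w [] = [if i \<le> j then (i, j, w) else (j, i, transpose_weight w)]"
| "add_edge i j w ((k, l, v) # N) =
    (if k = i \<and> l = j then (k, l, pointwise_weight w v) # N
     else if k = j \<and> l = i then (k, l, pointwise_weight (transpose_weight w) v) # N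
     else (k, l, v) # add_edge i j w N)"

fun star :: "nat \<Rightarrow> network \<Rightarrow> (nat \<times> weight) list" where
  "star k [] = []"
| "star k ((i, j, w) # N) =
    (if i = k then (j, w) # star k N else if j = k then (i, transpose_weight w) # star k N else star k N)"

definition delete_vertex :: "nat \<Rightarrow> network \<Rightarrow> network" where
  "delete_vertex k N = filter (\<lambda>(i, j, w). i \<noteq> k \<and> j \<noteq> k) N"

fun chordal :: "weight \<Rightarrow> bool" where
  "chordal (p, q, r) \<longleftrightarrow> q = r"

text \<open>
  \<open>eliminate S L N\<close> sums a variable with incident factors \<open>S @ L\<close> out of a network whose remaining
  factors are \<open>N\<close>. A weight \<open>(p, q, q)\<close> equals \<open>q J + (p - q) I\<close>: the first summand deletes the
  edge, the second one identifies the variable with its neighbour. The other weights are collected in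
  \<open>S\<close>; with more than two of them the variable cannot be eliminated.
\<close>

fun eliminate :: "(nat \<times> weight) list \<Rightarrow> (nat \<times> weight) list \<Rightarrow> network \<Rightarrow> (ipoly \<times> network) list option" where
  "eliminate S ((j, (p, q, r)) # L) N =
    (if q = r then
       (case eliminate S L N of None \<Rightarrow> None
        | Some E \<Rightarrow> Some ((padd p (psmult (-1) q), fold (\<lambda>(i, v). add_edge j i v) (S @ L) N)
            # map (\<lambda>(c, M). (pmult q c, M)) E))
     else eliminate ((j, (p, q, r)) # S) L N)"
| "eliminate [] [] N = Some [([3, 4], N)]"
| "eliminate [(j, (p, q, r))] [] N = Some [(padd p (pmult [1, 2] (padd q r)), N)]"
| "eliminate [(i, v), (j, w)] [] N = Some [([1], add_edge i j (compose_weight (transpose_weight v) w) N)]"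
| "eliminate S [] N = None"

fun combine :: "(ipoly \<times> ipoly option) list \<Rightarrow> ipoly option" where
  "combine [] = Some []"
| "combine ((c, Some P) # L) = map_option (padd (pmult c P)) (combine L)"
| "combine ((c, None) # L) = None"

text \<open>The variables for which \<open>eliminate\<close> succeeds.\<close>

definition reducible :: "network \<Rightarrow> nat \<Rightarrow> bool" where
  "reducible N k \<longleftrightarrow> length (filter (\<lambda>(j, w). \<not> chordal w) (star k N)) \<le> 2"

text \<open>
  The variables \<open>ks\<close> are summed over; \<open>x\<^sub>0 \<rightarrow> x\<^sub>1\<close> is a fixed arc, so the network that finally
  remains takes the \<open>A\<close>-coefficient of its only weight.
\<close>

function evaluate :: "nat list \<Rightarrow> network \<Rightarrow> ipoly option" where
  "evaluate ks N =
    (if (\<exists>(i, j, w) \<in> set N. w = ([], [], [])) then Some []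
     else if ks = [] then
       (case N of [(i, j, (p, q, r))] \<Rightarrow> if i = 0 \<and> j = 1 then Some q else None | _ \<Rightarrow> None)
     else case find (reducible N) ks of
         None \<Rightarrow> None
       | Some k \<Rightarrow>
          (let L = star k N in
           if (\<exists>(j, w) \<in> set L. j = k) then None
           else (case eliminate [] L (delete_vertex k N) of
               None \<Rightarrow> None
             | Some E \<Rightarrow> combine (map (\<lambda>(c, M). (c, evaluate (remove1 k ks) M)) E))))"
  by pat_completeness auto
termination
  by (relation "measure (\<lambda>(ks, N). length ks)")
    (auto simp: find_Some_iff length_remove1 length_greater_0_conv)

text \<open>
  Only vertices at distance 3 or 4 along the cycle have to be separated: closer ones differ because a
  tournament has neither loops nor 2-cycles.
\<close>

definition cycle_network :: network where
  "cycle_network =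
    map (\<lambda>(i, j). (i, j, ([], [1], []))) [(0,1), (1,2), (2,3), (3,4), (4,5), (5,6), (6,7)] @
    (0, 7, ([], [], [1])) #
    map (\<lambda>(i, j). (i, j, ([], [1], [1])))
     [(0,3), (1,4), (2,5), (3,6), (4,7), (0,5), (1,6), (2,7), (0,4), (1,5), (2,6), (3,7)]"


text \<open>The symbolic count, for all \<open>t\<close> at once; the result lists the coefficients
  of the claimed polynomial.\<close>

lemma evaluate_cycle_network:
  "evaluate [2, 3, 4, 5, 6, 7] cycle_network = Some [0, 0, 22, 8, -54, -8, 32]"
  by code_simp

declare evaluate.simps [simp del]

section \<open>Evaluation respects polynomial arithmetic\<close>

lemma ipoly_val_pcons [simp]: "ipoly_val x (pcons a p) = a + x * ipoly_val x p"
  by (simp add: pcons_def)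

lemma ipoly_val_padd [simp]: "ipoly_val x (padd p q) = ipoly_val x p + ipoly_val x q"
  by (induction p q rule: padd.induct) (simp_all add: algebra_simps)

lemma ipoly_val_psmult [simp]: "ipoly_val x (psmult a p) = a * ipoly_val x p"
  by (induction p) (simp_all add: psmult_def algebra_simps)

lemma ipoly_val_pmult [simp]: "ipoly_val x (pmult p q) = ipoly_val x p * ipoly_val x q"
  by (induction p) (simp_all add: algebra_simps)

section \<open>Cycles as cyclic lists of vertices\<close>

lemma (in pre_digraph) cas_iff: "cas u p v \<longleftrightarrow> u # map (head G) p = map (tail G) p @ [v]"
  by (induction u p v rule: cas.induct) auto

lemma (in pre_digraph) awalk_verts_eq: "cas u p v \<Longrightarrow> awalk_verts u p = u # map (head G) p"
  by (induction p arbitrary: u) auto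

lemma (in pre_digraph) closed_walk_iff:
  assumes "p \<noteq> []"
  shows "(\<exists>u. cas u p u) \<longleftrightarrow> map (head G) p = rotate1 (map (tail G) p)"
  using assms by (cases p) (auto simp: cas_iff)

text \<open>A directed cycle with a distinguished starting vertex; \<open>rotate1\<close> supplies
  the successors, including the wrap-around.\<close>

definition cyclic_list :: "('a, 'b) pre_digraph \<Rightarrow> 'a list \<Rightarrow> bool" where
  "cyclic_list G xs \<longleftrightarrow> distinct xs \<and> list_all2 (\<lambda>x y. x \<rightarrow>\<^bsub>G\<^esub> y) xs (rotate1 xs)"

definition cycle_through :: "('a, 'b) pre_digraph \<Rightarrow> 'a list \<Rightarrow> ('a, 'b) pre_digraph" where
  "cycle_through G xs = \<lparr> verts = set xs,
     arcs = {a \<in> arcs G. (tail G a, head G a) \<in> set (zip xs (rotate1 xs))},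
     tail = tail G, head = head G \<rparr>"

text \<open>The pairs form a successor relation, and distinctness makes it a function; the list is
  recovered by iterating it from the common first entry.\<close>

lemma distinct_eq_if_zip_rotate1_eq:
  assumes "distinct xs" "distinct ys" "length xs = length ys" "hd xs = hd ys"
    and zip: "set (zip xs (rotate1 xs)) = set (zip ys (rotate1 ys))"
  shows "xs = ys"
proof (rule nth_equalityI)
  fix i assume "i < length xs"
  then show "xs ! i = ys ! i"
  proof (induction i)
    case 0
    then show ?case using assms(3,4) by (metis hd_conv_nth length_0_conv less_nat_zero_code)
  next
    case (Suc i)
    then have "(xs ! i, xs ! Suc i) \<in> set (zip xs (rotate1 xs))"
      by (auto simp: in_set_zip nth_rotate1 intro!: exI[of _ i])
    then obtain j where j: "j < length ys" "ys ! j = xs ! i" "ys ! (Suc j mod length ys) = xs ! Suc i"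
      unfolding zip by (auto simp: in_set_zip nth_rotate1)
    then have "j = i"
      using Suc assms(2,3) by (simp add: nth_eq_iff_index_eq)
    then show ?case using j Suc.prems assms(3) by simp
  qed
qed fact

context digraph
begin

lemma arcs_with_ends:
  assumes "set p \<subseteq> arcs G"
  shows "{a \<in> arcs G. (tail G a, head G a) \<in> set (zip (map (tail G) p) (map (head G) p))} = set p"
  using assms no_multi_arcs
  by (auto simp: zip_map_map zip_same_conv_map arc_to_ends_def)

lemma obtain_arcs:
  assumes "list_all2 (\<lambda>x y. x \<rightarrow> y) xs ys"
  obtains p where "set p \<subseteq> arcs G" "map (tail G) p = xs" "map (head G) p = ys"
proof -
  have "\<exists>p. set p \<subseteq> arcs G \<and> map (tail G) p = xs \<and> map (head G) p = ys"
    using assms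
  proof (induction rule: list_all2_induct)
    case (Cons x xs y ys)
    then obtain p a where "set p \<subseteq> arcs G" "map (tail G) p = xs" "map (head G) p = ys"
      "a \<in> arcs G" "tail G a = x" "head G a = y"
      by (auto simp: arcs_ends_def arc_to_ends_def)
    then show ?case by (intro exI[of _ "a # p"]) auto
  qed simp
  then show ?thesis using that by blast
qed

lemma cycle_through_in_cycle_subgraphs:
  assumes xs: "cyclic_list G xs" and "xs \<noteq> []"
  shows "cycle_through G xs \<in> cycle_subgraphs G (length xs)"
proof -
  obtain p where p: "set p \<subseteq> arcs G" "map (tail G) p = xs" "map (head G) p = rotate1 xs"
    using xs obtain_arcs by (auto simp: cyclic_list_def)
  have C: "cycle_through G xs = \<lparr> verts = set xs, arcs = set p, tail = tail G, head = head G \<rparr>"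
    using arcs_with_ends[OF p(1)] by (simp add: cycle_through_def p)
  interpret C: pre_digraph "cycle_through G xs" .
  have "p \<noteq> []" using p assms(2) by auto
  then obtain u where u: "C.cas u p u"
    using C.closed_walk_iff[of p] p by (auto simp: C)
  have tails: "tail G ` set p = set xs" and heads: "head G ` set p = set xs"
    using p by (metis set_map, metis set_map set_rotate1)
  have "u \<in> set xs"
    using u[unfolded C.cas_iff] \<open>p \<noteq> []\<close> tails by (cases p) (auto simp: C)
  then have "C.cycle p"
    \<comment> \<open>The vertices after the start are the heads of \<open>p\<close>, that is
      \<open>rotate1 xs\<close>, which is distinct because \<open>xs\<close> is.\<close>
    unfolding C.cycle_def C.awalk_def using u \<open>p \<noteq> []\<close> xs
    by (intro exI[of _ u]) (auto simp: C.awalk_verts_eq, auto simp: C p cyclic_list_def)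
  moreover have "subgraph (cycle_through G xs) G"
    using p(1) tails heads wf_digraph_axioms
  proof -
    have "set xs \<subseteq> verts G"
      using p(1) by (auto simp flip: tails)
    moreover have "wf_digraph \<lparr> verts = set xs, arcs = set p, tail = tail G, head = head G \<rparr>"
      using tails heads by unfold_locales auto
    ultimately show ?thesis
      using p(1) wf_digraph_axioms by (auto simp: subgraph_def compatible_def C)
  qed
  moreover have "length p = length xs"
    using p(2) by auto
  ultimately show ?thesis
    using tails by (auto simp: cycle_subgraphs_def is_cycle_digraph_def C intro!: exI[of _ p])
qed

lemma obtain_cyclic_list:
  assumes "C \<in> cycle_subgraphs G m" "e \<in> arcs C"
  obtains xs where "cyclic_list G xs" "length xs = m" "hd xs = tail G e" "hd (rotate1 xs) = head G e"
    "C = cycle_through G xs"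
proof -
  have sub: "subgraph C G" using assms by (simp add: cycle_subgraphs_def)
  then have C: "arcs C \<subseteq> arcs G" "tail C = tail G" "head C = head G"
    by (auto simp: subgraph_def compatible_def)
  interpret C: pre_digraph C .
  obtain p u where cas: "C.cas u p u" and "distinct (tl (C.awalk_verts u p))"
    and p: "length p = m" "arcs C = set p" "verts C = tail C ` set p"
    using assms by (auto simp: cycle_subgraphs_def is_cycle_digraph_def C.cycle_def C.awalk_def)
  then have dist: "distinct (map (head G) p)"
    by (simp add: C.awalk_verts_eq C)
  obtain q r where q: "p = q @ e # r"
    using assms(2) p(2) by (metis split_list)
  \<comment> \<open>Rotating the closed walk makes \<open>e\<close> its first arc.\<close>
  define p' where "p' = e # r @ q"
  have p': "p' = rotate (length q) p"
    by (simp add: p'_def q rotate_append)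
  have "map (head G) p = rotate1 (map (tail G) p)"
    using cas q C.closed_walk_iff[of p] by (auto simp: C)
  then have heads: "map (head G) p' = rotate1 (map (tail G) p')"
    by (simp add: p' rotate_map[symmetric] rotate1_rotate_swap)
  have "distinct (map (head G) p')"
    using dist by (simp add: p' rotate_map[symmetric])
  then have "distinct (map (tail G) p')"
    by (simp add: heads)
  moreover have arcs: "set p' \<subseteq> arcs G"
    using C p by (simp add: p')
  then have "list_all2 (\<lambda>x y. x \<rightarrow> y) (map (tail G) p') (map (head G) p')"
    by (auto simp: list_all2_conv_all_nth arcs_ends_def arc_to_ends_def intro!: imageI)
  ultimately have "cyclic_list G (map (tail G) p')"
    by (simp add: cyclic_list_def flip: heads)
  moreover have "C = cycle_through G (map (tail G) p')"
    using arcs_with_ends[OF arcs, unfolded heads] p C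
    by (simp add: cycle_through_def p')
  moreover have "hd (rotate1 (map (tail G) p')) = head G e"
    by (simp flip: heads) (simp add: p'_def)
  ultimately show ?thesis
    using that[of "map (tail G) p'"] p(1) by (simp add: p'_def q)
qed

text \<open>The arcs determine the successor relation, and fixing the first vertex excludes
  rotations.\<close>

lemma inj_on_cycle_through:
  "inj_on (cycle_through G) {xs. cyclic_list G xs \<and> length xs = m \<and> hd xs = v}"
proof (rule inj_onI, clarify)
  fix xs ys
  assume xs: "cyclic_list G xs" and ys: "cyclic_list G ys" and "cycle_through G xs = cycle_through G ys"
    and *: "m = length xs" "v = hd xs" "length ys = length xs" "hd ys = hd xs"
  then have "arcs (cycle_through G xs) = arcs (cycle_through G ys)" by simp
  moreover have "set (zip zs (rotate1 zs))
      = (\<lambda>a. (tail G a, head G a)) ` arcs (cycle_through G zs)" if zs: "cyclic_list G zs" for zs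
    using zs by (fastforce simp: cyclic_list_def cycle_through_def list_all2_iff arcs_ends_def arc_to_ends_def)
  ultimately show "xs = ys"
    using xs ys * by (intro distinct_eq_if_zip_rotate1_eq) (auto simp: cyclic_list_def)
qed

text \<open>Starting at the tail of \<open>e\<close> gives each cycle exactly one vertex list, whose
  second entry is then the head of \<open>e\<close>.\<close>

lemma card_cycle_subgraphs_through_arc:
  assumes e: "e \<in> arcs G"
  shows "card {C \<in> cycle_subgraphs G (Suc (Suc n)). e \<in> arcs C}
    = card {ys. set ys \<subseteq> verts G \<and> length ys = n \<and> cyclic_list G (tail G e # head G e # ys)}"
    (is "card ?C = card ?Y")
proof -
  let ?f = "\<lambda>ys. cycle_through G (tail G e # head G e # ys)"
  have "bij_betw ?f ?Y ?C"
  proof (intro bij_betw_imageI)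
    show "inj_on ?f ?Y"
    proof (rule inj_onI)
      fix ys zs assume "ys \<in> ?Y" "zs \<in> ?Y" "?f ys = ?f zs"
      then show "ys = zs"
        using inj_onD[OF inj_on_cycle_through[of "Suc (Suc n)" "tail G e"],
            of "tail G e # head G e # ys" "tail G e # head G e # zs"] by simp
    qed
    show "?f ` ?Y = ?C"
    proof (intro equalityI subsetI)
      fix C assume "C \<in> ?f ` ?Y"
      then obtain ys where ys: "length ys = n" "cyclic_list G (tail G e # head G e # ys)"
        and C: "C = cycle_through G (tail G e # head G e # ys)"
        by auto
      have "e \<in> arcs C" using e by (simp add: C cycle_through_def)
      then show "C \<in> ?C"
        using cycle_through_in_cycle_subgraphs[OF ys(2)] ys(1) C by simp
    next
      fix C assume "C \<in> ?C"
      then obtain xs where xs: "cyclic_list G xs" "length xs = Suc (Suc n)" "hd xs = tail G e"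
        "hd (rotate1 xs) = head G e" "C = cycle_through G xs"
        using obtain_cyclic_list[of C "Suc (Suc n)" e] by blast
      then obtain ys where ys: "xs = tail G e # head G e # ys" "length ys = n"
        by (auto simp: length_Suc_conv)
      have "set xs \<subseteq> verts G"
        using xs(1) by (auto simp: cyclic_list_def list_all2_conv_all_nth in_set_conv_nth)
          (meson adj_in_verts(1))
      with xs ys show "C \<in> ?f ` ?Y" by auto
    qed
  qed
  then show ?thesis by (simp add: bij_betw_same_card)
qed

end

lemma sum_lists_length_Suc:
  assumes "finite A"
  shows "(\<Sum>ys | set ys \<subseteq> A \<and> length ys = Suc n. f ys)
    = (\<Sum>x\<in>A. \<Sum>ys | set ys \<subseteq> A \<and> length ys = n. f (x # ys))"
proof -
  have "(\<Sum>ys | set ys \<subseteq> A \<and> length ys = Suc n. f ys)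
      = (\<Sum>(ys, x) \<in> {ys. set ys \<subseteq> A \<and> length ys = n} \<times> A. f (x # ys))"
    by (simp add: lists_length_Suc_eq sum.reindex inj_on_def case_prod_unfold)
  then show ?thesis
    by (simp add: sum.cartesian_product[symmetric] sum.swap[of _ A])
qed

section \<open>Soundness of the evaluator\<close>

lemma (in digraph) out_degree_eq_card_out_set: "out_degree G v = card (out_set G v)"
proof -
  have "inj_on (head G) (out_arcs G v)"
    using no_multi_arcs by (auto simp: inj_on_def out_arcs_def arc_to_ends_def)
  moreover have "head G ` out_arcs G v = out_set G v"
    by (auto simp: out_set_def out_arcs_def arcs_ends_def arc_to_ends_def image_iff)
  ultimately show ?thesis
    using card_image by (fastforce simp: out_degree_def)
qed

locale doubly_regular_of_order = doubly_regular_tournament T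
  for T :: "('a, 'b) pre_digraph" (structure) +
  fixes t :: nat
  assumes card_verts: "card (verts T) = 4 * t + 3"
begin

section \<open>Matrix identities of a doubly-regular tournament\<close>

abbreviation adj :: "'a \<Rightarrow> 'a \<Rightarrow> int" where
  "adj x y \<equiv> of_bool (x \<rightarrow> y)"

lemma not_dominates_self [simp]: "\<not> x \<rightarrow> x"
  using adj_not_same by blast

lemma dominates_antisym: "x \<rightarrow> y \<Longrightarrow> \<not> y \<rightarrow> x"
  using exactly_one_dominates[of x y] by (cases "x = y") auto

text \<open>The identity \<open>I + A + A\<^sup>T = J\<close>.\<close>

lemma adj_trichotomy:
  "x \<in> verts T \<Longrightarrow> y \<in> verts T \<Longrightarrow> adj x y = 1 - adj y x - of_bool (x = y)"
  using exactly_one_dominates[of x y] by (cases "x = y") auto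

lemma card_out_set: "x \<in> verts T \<Longrightarrow> card (out_set T x) = 2 * t + 1"
  using out_degree_regular[of x] card_verts by (simp add: out_degree_eq_card_out_set)

text \<open>The common out-neighbours are the out-neighbours of \<open>y\<close> inside the out-set
  of \<open>x\<close>, a regular tournament of order \<open>2t + 1\<close>.\<close>

lemma card_common_out_set:
  assumes "x \<rightarrow> y"
  shows "card (out_set T x \<inter> out_set T y) = t"
proof -
  have x: "x \<in> verts T" and y: "y \<in> out_set T x"
    using assms by (auto simp: out_set_def)
  interpret S: regular_tournament "T \<restriction> out_set T x"
    using out_set_regular[OF x] .
  have "out_set (T \<restriction> out_set T x) y = out_set T x \<inter> out_set T y"
    using y by (auto simp: out_set_def arcs_ends_def arc_to_ends_def image_iff) metis
  then show ?thesis
    using S.out_degree_regular[of y] y card_out_set[OF x]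
    by (simp add: S.out_degree_eq_card_out_set)
qed

lemma sum_adj_out: "x \<in> verts T \<Longrightarrow> (\<Sum>z\<in>verts T. adj x z) = 2 * int t + 1"
proof -
  assume x: "x \<in> verts T"
  have "verts T \<inter> {z. x \<rightarrow> z} = out_set T x"
    by (auto simp: out_set_def)
  then show ?thesis
    using card_out_set[OF x] by (simp add: sum_of_bool_eq)
qed

lemma sum_adj_in:
  assumes "x \<in> verts T"
  shows "(\<Sum>z\<in>verts T. adj z x) = 2 * int t + 1"
proof -
  have "(\<Sum>z\<in>verts T. adj z x) = (\<Sum>z\<in>verts T. 1 - adj x z - of_bool (z = x))"
    by (intro sum.cong refl adj_trichotomy) (use assms in auto)
  then show ?thesis
    using assms card_verts
    by (simp add: sum_subtractf sum_adj_out[unfolded of_bool_def] of_bool_def del: sum_of_bool_eq)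
qed

text \<open>The entries of \<open>A A\<^sup>T\<close>: off the diagonal, one of \<open>x\<close>,
  \<open>y\<close> dominates the other, and the count of common out-neighbours is symmetric.\<close>

lemma sum_adj_out_out:
  assumes "x \<in> verts T" "y \<in> verts T"
  shows "(\<Sum>z\<in>verts T. adj x z * adj y z) = int t + (int t + 1) * of_bool (x = y)"
proof (cases "x = y")
  case True
  then show ?thesis using sum_adj_out[OF assms(1)] by simp
next
  case False
  have "verts T \<inter> {z. x \<rightarrow> z \<and> y \<rightarrow> z} = out_set T x \<inter> out_set T y"
    by (auto simp: out_set_def)
  moreover have "card (out_set T x \<inter> out_set T y) = t"
    using exactly_one_dominates[OF assms False] card_common_out_set
    by (metis Int_commute)
  ultimately show ?thesis
    using False by (simp add: sum_of_bool_eq flip: of_bool_conj)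
qed

text \<open>The entries of \<open>A\<^sup>2\<close>, computed as
  \<open>A (J - I - A\<^sup>T)\<close>.\<close>

lemma sum_adj_out_in:
  assumes "x \<in> verts T" "y \<in> verts T"
  shows "(\<Sum>z\<in>verts T. adj x z * adj z y) = int t * adj x y + (int t + 1) * adj y x"
proof -
  have "(\<Sum>z\<in>verts T. adj x z * adj z y)
      = (\<Sum>z\<in>verts T. adj x z - adj x z * adj y z - (if z = y then adj x z else 0))"
  proof (intro sum.cong refl)
    fix z assume "z \<in> verts T"
    then show "adj x z * adj z y = adj x z - adj x z * adj y z - (if z = y then adj x z else 0)"
      using assms by (subst adj_trichotomy[of z y]) (auto simp: algebra_simps)
  qed
  also have "\<dots> = (2 * int t + 1) - (int t + (int t + 1) * of_bool (x = y)) - adj x y"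
    using assms by (simp only: sum_subtractf sum_adj_out sum_adj_out_out sum.delta finite_verts if_True)
  also have "\<dots> = int t * adj x y + (int t + 1) * adj y x"
    using exactly_one_dominates[OF assms] by (auto simp: of_bool_def)
  finally show ?thesis .
qed

text \<open>The entries of \<open>A\<^sup>T A\<close>, computed as
  \<open>(J - I - A) A\<close>.\<close>

lemma sum_adj_in_in:
  assumes "x \<in> verts T" "y \<in> verts T"
  shows "(\<Sum>z\<in>verts T. adj z x * adj z y) = int t + (int t + 1) * of_bool (x = y)"
proof -
  have "(\<Sum>z\<in>verts T. adj z x * adj z y)
      = (\<Sum>z\<in>verts T. adj z y - adj x z * adj z y - (if z = x then adj z y else 0))"
  proof (intro sum.cong refl)
    fix z assume "z \<in> verts T"
    then show "adj z x * adj z y = adj z y - adj x z * adj z y - (if z = x then adj z y else 0)"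
      using assms by (subst adj_trichotomy[of z x]) (auto simp: algebra_simps)
  qed
  also have "\<dots> = (2 * int t + 1) - (int t * adj x y + (int t + 1) * adj y x) - adj x y"
    using assms by (simp only: sum_subtractf sum_adj_in sum_adj_out_in sum.delta finite_verts if_True)
  also have "\<dots> = int t + (int t + 1) * of_bool (x = y)"
    using exactly_one_dominates[OF assms] by (auto simp: of_bool_def)
  finally show ?thesis .
qed

section \<open>Weights as matrices\<close>

abbreviation pval :: "ipoly \<Rightarrow> int" where
  "pval \<equiv> ipoly_val (int t)"

fun weight_val :: "weight \<Rightarrow> 'a \<Rightarrow> 'a \<Rightarrow> int" where
  "weight_val (p, q, r) x y = pval p * of_bool (x = y) + pval q * adj x y + pval r * adj y x"

lemma weight_val_transpose [simp]: "weight_val (transpose_weight w) x y = weight_val w y x"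
  by (cases w) auto

text \<open>\<open>I\<close>, \<open>A\<close> and \<open>A\<^sup>T\<close> are 0/1 matrices with
  disjoint supports.\<close>

lemma weight_val_pointwise:
  assumes "x \<in> verts T" "y \<in> verts T"
  shows "weight_val (pointwise_weight v w) x y = weight_val v x y * weight_val w x y"
  using exactly_one_dominates[OF assms] by (cases v; cases w) (auto simp: of_bool_def)

lemma weight_val_compose:
  assumes "x \<in> verts T" "y \<in> verts T"
  shows "(\<Sum>z\<in>verts T. weight_val v x z * weight_val w z y) = weight_val (compose_weight v w) x y"
proof -
  obtain p q r p' q' r' where v: "v = (p, q, r)" and w: "w = (p', q', r')"
    by (metis prod.exhaust)
  \<comment> \<open>The term at \<open>z = y\<close> omits \<open>pval p\<close>, which is already
    counted at \<open>z = x\<close>. The last product is written from \<open>y\<close> to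
    \<open>x\<close>, as an entry of \<open>A\<^sup>2\<close> with swapped arguments.\<close>
  have "(\<Sum>z\<in>verts T. weight_val v x z * weight_val w z y)
    = (\<Sum>z\<in>verts T. (if z = x then pval p * weight_val w x y else 0)
        + (if z = y then pval p' * (pval q * adj x y + pval r * adj y x) else 0)
        + pval q * pval q' * (adj x z * adj z y) + pval q * pval r' * (adj x z * adj y z)
        + pval r * pval q' * (adj z x * adj z y) + pval r * pval r' * (adj y z * adj z x))"
    by (intro sum.cong refl) (auto simp: v w algebra_simps)
  also have "\<dots> = pval p * weight_val w x y + pval p' * (pval q * adj x y + pval r * adj y x)
        + pval q * pval q' * (int t * adj x y + (int t + 1) * adj y x)
        + (pval q * pval r' + pval r * pval q') * (int t + (int t + 1) * of_bool (x = y))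
        + pval r * pval r' * (int t * adj y x + (int t + 1) * adj x y)"
    using assms
    by (simp only: sum.distrib sum_adj_out_in sum_adj_out_out sum_adj_in_in sum.delta
        finite_verts if_True distrib_right flip: sum_distrib_left)
  also have "\<dots> = weight_val (compose_weight v w) x y"
    using exactly_one_dominates[OF assms] by (auto simp: v w Let_def algebra_simps of_bool_def)
  finally show ?thesis .
qed

lemma sum_weight_val:
  assumes "x \<in> verts T"
  shows "(\<Sum>z\<in>verts T. weight_val (p, q, r) z x) = pval p + (2 * int t + 1) * (pval q + pval r)"
  using assms
  by (simp add: sum.distrib sum_adj_in sum_adj_out algebra_simps del: sum_of_bool_eq
      flip: sum_distrib_left)

section \<open>Elimination of one variable\<close>

definition network_val :: "network \<Rightarrow> (nat \<Rightarrow> 'a) \<Rightarrow> int" where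
  "network_val N \<sigma> = (\<Prod>(i, j, w)\<leftarrow>N. weight_val w (\<sigma> i) (\<sigma> j))"

definition star_val :: "(nat \<times> weight) list \<Rightarrow> 'a \<Rightarrow> (nat \<Rightarrow> 'a) \<Rightarrow> int" where
  "star_val L x \<sigma> = (\<Prod>(j, w)\<leftarrow>L. weight_val w x (\<sigma> j))"

lemma network_val_simps [simp]:
  "network_val [] \<sigma> = 1"
  "network_val ((i, j, w) # N) \<sigma> = weight_val w (\<sigma> i) (\<sigma> j) * network_val N \<sigma>"
  by (simp_all add: network_val_def)

lemma star_val_simps [simp]:
  "star_val [] x \<sigma> = 1"
  "star_val ((j, w) # L) x \<sigma> = weight_val w x (\<sigma> j) * star_val L x \<sigma>"
  "star_val (L @ L') x \<sigma> = star_val L x \<sigma> * star_val L' x \<sigma>"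
  by (simp_all add: star_val_def)

lemma network_val_add_edge:
  assumes "range \<sigma> \<subseteq> verts T"
  shows "network_val (add_edge i j w N) \<sigma> = weight_val w (\<sigma> i) (\<sigma> j) * network_val N \<sigma>"
  using assms
  by (induction i j w N rule: add_edge.induct) (auto simp: weight_val_pointwise range_subsetD)

lemma network_val_fold_add_edge:
  assumes "range \<sigma> \<subseteq> verts T"
  shows "network_val (fold (\<lambda>(i, v). add_edge j i v) L N) \<sigma> = star_val L (\<sigma> j) \<sigma> * network_val N \<sigma>"
  by (induction L arbitrary: N) (auto simp: network_val_add_edge[OF assms])

text \<open>Without loops at \<open>k\<close>, each factor at \<open>k\<close> depends on
  \<open>x\<close> and one value that the update leaves alone; the other factors do not see
  \<open>x\<close>.\<close>

lemma network_val_upd: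
  assumes "\<forall>(j, w)\<in>set (star k N). j \<noteq> k"
  shows "network_val N (\<sigma>(k := x)) = star_val (star k N) x \<sigma> * network_val (delete_vertex k N) \<sigma>"
  using assms
  by (induction k N rule: star.induct) (auto simp: delete_vertex_def split: if_splits)

lemma eliminate_sound:
  assumes "eliminate S L N = Some E" and \<sigma>: "range \<sigma> \<subseteq> verts T"
  shows "(\<Sum>x\<in>verts T. star_val (S @ L) x \<sigma> * network_val N \<sigma>)
    = (\<Sum>(c, M)\<leftarrow>E. pval c * network_val M \<sigma>)"
  using assms(1)
proof (induction S L N arbitrary: E rule: eliminate.induct)
  case (1 S j p q r L N)
  have j: "\<sigma> j \<in> verts T" using \<sigma> by auto
  show ?case
  proof (cases "q = r")
    case True
    then obtain E' where E': "eliminate S L N = Some E'"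
      and E: "E = (padd p (psmult (-1) q), fold (\<lambda>(i, v). add_edge j i v) (S @ L) N)
            # map (\<lambda>(c, M). (pmult q c, M)) E'"
      using 1(3) by (auto split: option.splits)
    \<comment> \<open>The \<open>I\<close> part forces \<open>x = \<sigma> j\<close>, turning the
      rest of the star into edges at \<open>j\<close>.\<close>
    have "(\<Sum>x\<in>verts T. star_val (S @ (j, p, q, r) # L) x \<sigma> * network_val N \<sigma>)
      = (\<Sum>x\<in>verts T. pval q * (star_val (S @ L) x \<sigma> * network_val N \<sigma>)
          + (if x = \<sigma> j then (pval p - pval q) * (star_val (S @ L) (\<sigma> j) \<sigma> * network_val N \<sigma>) else 0))"
    proof (intro sum.cong refl)
      fix x assume "x \<in> verts T"
      then have "weight_val (p, q, r) x (\<sigma> j) = pval q + (pval p - pval q) * of_bool (x = \<sigma> j)"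
        using exactly_one_dominates[OF _ j, of x] True by (auto simp: algebra_simps)
      then show "star_val (S @ (j, p, q, r) # L) x \<sigma> * network_val N \<sigma>
        = pval q * (star_val (S @ L) x \<sigma> * network_val N \<sigma>)
          + (if x = \<sigma> j then (pval p - pval q) * (star_val (S @ L) (\<sigma> j) \<sigma> * network_val N \<sigma>) else 0)"
        by (auto simp del: weight_val.simps simp: algebra_simps)
    qed
    also have "\<dots> = pval q * (\<Sum>x\<in>verts T. star_val (S @ L) x \<sigma> * network_val N \<sigma>)
       + (pval p - pval q) * (star_val (S @ L) (\<sigma> j) \<sigma> * network_val N \<sigma>)"
      using j by (simp only: sum.distrib sum.delta finite_verts if_True flip: sum_distrib_left)
    also have "\<dots> = (\<Sum>(c, M)\<leftarrow>E. pval c * network_val M \<sigma>)"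
      unfolding 1(1)[OF True E'] E
      by (simp add: network_val_fold_add_edge[OF \<sigma>, unfolded case_prod_unfold]
          sum_list_const_mult[symmetric] comp_def case_prod_unfold mult.assoc del: fold_append)
    finally show ?thesis .
  next
    case False
    then show ?thesis using 1(2)[OF False] 1(3) by (simp add: mult_ac)
  qed
next
  \<comment> \<open>No factor remains, so the sum counts all \<open>4t + 3\<close> vertices.\<close>
  case (2 N)
  then show ?case using card_verts by auto
next
  \<comment> \<open>One factor remains: a row sum, constant because all in- and out-degrees are
    \<open>2t + 1\<close>.\<close>
  case (3 j p q r N)
  then show ?case using \<sigma> sum_weight_val[of "\<sigma> j" p q r]
    by (auto simp: range_subsetD simp flip: sum_distrib_right simp del: weight_val.simps)
      (simp add: algebra_simps)
next
  \<comment> \<open>Two factors remain: a path through \<open>x\<close>, contracted by the matrix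
    product.\<close>
  case (4 i v j w N)
  have "\<sigma> i \<in> verts T" "\<sigma> j \<in> verts T" using \<sigma> by auto
  note weight_val_compose[OF this, of "transpose_weight v" w]
  with 4 show ?case
    by (auto simp: network_val_add_edge[OF \<sigma>] simp flip: sum_distrib_right)
qed auto

section \<open>Iterated sums and the recursive evaluation\<close>

primrec sum_over :: "nat list \<Rightarrow> ((nat \<Rightarrow> 'a) \<Rightarrow> int) \<Rightarrow> (nat \<Rightarrow> 'a) \<Rightarrow> int" where
  "sum_over [] F \<sigma> = F \<sigma>"
| "sum_over (k # ks) F \<sigma> = (\<Sum>x\<in>verts T. sum_over ks F (\<sigma>(k := x)))"

lemma sum_over_inner:
  "k \<notin> set ks \<Longrightarrow>
    (\<Sum>x\<in>verts T. sum_over ks F (\<sigma>(k := x))) = sum_over ks (\<lambda>\<sigma>. \<Sum>x\<in>verts T. F (\<sigma>(k := x))) \<sigma>"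
proof (induction ks arbitrary: \<sigma>)
  case (Cons l ks)
  then have "(\<Sum>x\<in>verts T. sum_over (l # ks) F (\<sigma>(k := x)))
    = (\<Sum>x\<in>verts T. \<Sum>y\<in>verts T. sum_over ks F (\<sigma>(l := y, k := x)))"
    by (simp add: fun_upd_twist)
  also have "\<dots> = (\<Sum>y\<in>verts T. \<Sum>x\<in>verts T. sum_over ks F (\<sigma>(l := y, k := x)))"
    by (rule sum.swap)
  finally show ?case using Cons by (simp del: fun_upd_apply)
qed simp

text \<open>By exchanging sums, whichever variable \<open>evaluate\<close> picks becomes the
  innermost one.\<close>

lemma sum_over_remove1:
  assumes "k \<in> set ks" "distinct ks"
  shows "sum_over ks F \<sigma> = sum_over (remove1 k ks) (\<lambda>\<sigma>. \<Sum>x\<in>verts T. F (\<sigma>(k := x))) \<sigma>"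
  using assms
proof (induction ks arbitrary: \<sigma>)
  case (Cons l ks)
  then show ?case
    by (cases "l = k") (simp_all add: sum_over_inner del: fun_upd_apply)
qed simp

text \<open>The matrix identities hold only at vertices, so equality is required only for
  assignments into \<open>verts T\<close>, a property that every update in the sum
  preserves.\<close>

lemma sum_over_cong:
  assumes "\<And>\<sigma>. range \<sigma> \<subseteq> verts T \<Longrightarrow> F \<sigma> = G \<sigma>" "range \<sigma> \<subseteq> verts T"
  shows "sum_over ks F \<sigma> = sum_over ks G \<sigma>"
  using assms(2)
proof (induction ks arbitrary: \<sigma>)
  case (Cons k ks)
  then have "range (\<sigma>(k := x)) \<subseteq> verts T" if "x \<in> verts T" for x
    using that by auto
  then show ?case using Cons by (simp del: fun_upd_apply)
qed (use assms(1) in auto)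

lemma sum_over_linear:
  "sum_over ks (\<lambda>\<sigma>. \<Sum>(c, M)\<leftarrow>E. f c * F M \<sigma>) \<sigma> = (\<Sum>(c, M)\<leftarrow>E. f c * sum_over ks (F M) \<sigma>)"
proof (induction ks arbitrary: \<sigma>)
  case (Cons k ks)
  have "(\<Sum>x\<in>V. \<Sum>(c, M)\<leftarrow>E. f c * G M x) = (\<Sum>(c, M)\<leftarrow>E. f c * (\<Sum>x\<in>V. G M x))" for V :: "'a set" and G
    by (induction E) (auto simp: sum.distrib sum_distrib_left)
  then show ?case using Cons by (simp del: fun_upd_apply)
qed simp

lemma combine_sound:
  assumes "combine (map (\<lambda>(c, M). (c, f M)) E) = Some P"
    and "\<And>M Q. M \<in> snd ` set E \<Longrightarrow> f M = Some Q \<Longrightarrow> F M = pval Q"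
  shows "(\<Sum>(c, M)\<leftarrow>E. pval c * F M) = pval P"
  using assms
proof (induction E arbitrary: P)
  case (Cons cM E)
  obtain c M where [simp]: "cM = (c, M)" by fastforce
  show ?case
    using Cons by (cases "f M") auto
qed simp

lemma evaluate_sound:
  assumes "evaluate ks N = Some P" "distinct ks" "0 \<notin> set ks" "1 \<notin> set ks"
    and "range \<sigma> \<subseteq> verts T" "\<sigma> 0 \<rightarrow> \<sigma> 1"
  shows "sum_over ks (network_val N) \<sigma> = pval P"
  using assms(1-4)
proof (induction ks N arbitrary: P rule: evaluate.induct)
  case (1 ks N)
  note eval = 1(2)[unfolded evaluate.simps[of ks N]]
  consider (zero) "\<exists>(i, j, w) \<in> set N. w = ([], [], [])"
    | (base) "\<not> (\<exists>(i, j, w) \<in> set N. w = ([], [], []))" "ks = []"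
    | (step) "\<not> (\<exists>(i, j, w) \<in> set N. w = ([], [], []))" "ks \<noteq> []"
    by blast
  then show ?case
  proof cases
    \<comment> \<open>Merging two opposite arcs yields this weight, so networks with a 2-cycle end
      here.\<close>
    case zero
    then have "network_val N = (\<lambda>\<sigma>. 0)"
      by (force simp: network_val_def prod_list_zero_iff)
    moreover have "sum_over ks (\<lambda>\<sigma>. 0) \<sigma> = 0"
      by (induction ks arbitrary: \<sigma>) auto
    ultimately show ?thesis using eval zero by auto
  next
    \<comment> \<open>On the arc from \<open>\<sigma> 0\<close> to \<open>\<sigma> 1\<close> the
      matrices \<open>I\<close> and \<open>A\<^sup>T\<close> vanish, leaving
      \<open>q\<close>.\<close>
    case base
    then obtain p q r where "N = [(0, 1, p, q, r)]" "P = q"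
      using eval by (auto split: list.splits prod.splits if_splits)
    then show ?thesis
      using base assms(5,6) exactly_one_dominates[of "\<sigma> 0" "\<sigma> 1"] by auto
  next
    case step
    then obtain k E where k: "find (reducible N) ks = Some k"
      and loopless: "\<forall>(j, w)\<in>set (star k N). j \<noteq> k"
      and E: "eliminate [] (star k N) (delete_vertex k N) = Some E"
      and P: "combine (map (\<lambda>(c, M). (c, evaluate (remove1 k ks) M)) E) = Some P"
      using eval by (fastforce simp: Let_def split: option.splits if_splits)
    have "k \<in> set ks"
      using k by (auto simp: find_Some_iff)
    have IH: "sum_over (remove1 k ks) (network_val M) \<sigma> = pval Q"
      if M: "M \<in> snd ` set E" and Q: "evaluate (remove1 k ks) M = Some Q" for M Q
      proof -
      obtain c where "(c, M) \<in> set E" using M by auto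
      then show ?thesis
        using 1(1)[OF step k refl _ E, of "(c, M)" c M] Q loopless 1(3-5) by auto
    qed
    have "sum_over ks (network_val N) \<sigma>
      = sum_over (remove1 k ks) (\<lambda>\<sigma>. \<Sum>x\<in>verts T. network_val N (\<sigma>(k := x))) \<sigma>"
      using \<open>k \<in> set ks\<close> 1(3) by (rule sum_over_remove1)
    also have "\<dots> = sum_over (remove1 k ks) (\<lambda>\<sigma>. \<Sum>(c, M)\<leftarrow>E. pval c * network_val M \<sigma>) \<sigma>"
      using eliminate_sound[OF E] assms(5)
      by (intro sum_over_cong) (simp_all add: network_val_upd[OF loopless])
    also have "\<dots> = pval P"
      unfolding sum_over_linear using P IH by (rule combine_sound)
    finally show ?thesis .
  qed
qed

section \<open>The 8-cycle network and the final count\<close>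

lemma network_val_cycle_network:
  assumes "range \<sigma> \<subseteq> verts T"
  shows "network_val cycle_network \<sigma> = of_bool (cyclic_list T (map \<sigma> [0, 1, 2, 3, 4, 5, 6, 7]))"
proof -
  have wt: "weight_val ([], [1], []) x y = adj x y" "weight_val ([], [], [1]) x y = adj y x" for x y
    by simp_all
  have ne: "weight_val ([], [1], [1]) (\<sigma> i) (\<sigma> j) = of_bool (\<sigma> i \<noteq> \<sigma> j)" for i j
    using exactly_one_dominates[of "\<sigma> i" "\<sigma> j"] assms by (auto simp: range_subsetD)
  have antisym: "\<sigma> i \<rightarrow> \<sigma> j \<Longrightarrow> \<sigma> j \<rightarrow> \<sigma> k \<Longrightarrow> \<sigma> i \<noteq> \<sigma> k" for i j k
    using dominates_antisym[of "\<sigma> i" "\<sigma> j"] by auto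
  let ?closed = "\<sigma> 0 \<rightarrow> \<sigma> 1 \<and> \<sigma> 1 \<rightarrow> \<sigma> 2 \<and> \<sigma> 2 \<rightarrow> \<sigma> 3 \<and> \<sigma> 3 \<rightarrow> \<sigma> 4 \<and>
    \<sigma> 4 \<rightarrow> \<sigma> 5 \<and> \<sigma> 5 \<rightarrow> \<sigma> 6 \<and> \<sigma> 6 \<rightarrow> \<sigma> 7 \<and> \<sigma> 7 \<rightarrow> \<sigma> 0"
  let ?ne = "\<lambda>i j. \<sigma> i \<noteq> \<sigma> j"
  \<comment> \<open>The 16 pairs at cyclic distance 1 or 2; with the 12 inequations in the network
    they make up all 28 pairs.\<close>
  have near: "?ne 0 1 \<and> ?ne 1 2 \<and> ?ne 2 3 \<and> ?ne 3 4 \<and> ?ne 4 5 \<and> ?ne 5 6 \<and> ?ne 6 7 \<and> ?ne 0 7 \<and>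
      ?ne 0 2 \<and> ?ne 1 3 \<and> ?ne 2 4 \<and> ?ne 3 5 \<and> ?ne 4 6 \<and> ?ne 5 7 \<and> ?ne 0 6 \<and> ?ne 1 7" if ?closed
    using that antisym[of 0 1 2] antisym[of 1 2 3] antisym[of 2 3 4] antisym[of 3 4 5]
      antisym[of 4 5 6] antisym[of 5 6 7] antisym[of 6 7 0] antisym[of 7 0 1]
    by (intro conjI) (metis not_dominates_self)+
  have "network_val cycle_network \<sigma> = of_bool (?closed \<and>
      ?ne 0 3 \<and> ?ne 1 4 \<and> ?ne 2 5 \<and> ?ne 3 6 \<and> ?ne 4 7 \<and> ?ne 0 5 \<and> ?ne 1 6 \<and> ?ne 2 7 \<and>
      ?ne 0 4 \<and> ?ne 1 5 \<and> ?ne 2 6 \<and> ?ne 3 7)"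
    by (simp only: cycle_network_def list.map append.simps prod.case network_val_simps wt ne
        mult_1_right conj_assoc flip: of_bool_conj)
  also have "\<dots> = of_bool (cyclic_list T (map \<sigma> [0, 1, 2, 3, 4, 5, 6, 7]))"
  proof (rule arg_cong[of _ _ of_bool], cases ?closed)
    case True
    then show "(?closed \<and>
        ?ne 0 3 \<and> ?ne 1 4 \<and> ?ne 2 5 \<and> ?ne 3 6 \<and> ?ne 4 7 \<and> ?ne 0 5 \<and> ?ne 1 6 \<and> ?ne 2 7 \<and>
        ?ne 0 4 \<and> ?ne 1 5 \<and> ?ne 2 6 \<and> ?ne 3 7) = cyclic_list T (map \<sigma> [0, 1, 2, 3, 4, 5, 6, 7])"
      using near[OF True]
      by (simp only: cyclic_list_def rotate1.simps append.simps list.map list_all2_Cons list_all2_Nil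
          distinct.simps list.set insert_iff empty_iff) (simp add: conj_ac)
  qed (auto simp only: cyclic_list_def rotate1.simps append.simps list.map list_all2_Cons)
  finally show ?thesis .
qed

lemma card_8_cycles:
  assumes e: "e \<in> arcs T"
  shows "int (card {C \<in> cycle_subgraphs T 8. e \<in> arcs C}) =
    2 * (int t + 1) * (int t - 1) * (int t)\<^sup>2 * (16 * (int t)\<^sup>2 - 4 * int t - 11)"
proof -
  \<comment> \<open>Only the values at 0 and 1 matter; those at 2 to 7 get overwritten, and the
    default keeps the range inside \<open>verts T\<close>.\<close>
  define \<sigma> where "\<sigma> i = (if i = 1 then head T e else tail T e)" for i :: nat
  have \<sigma>: "range \<sigma> \<subseteq> verts T" "\<sigma> 0 \<rightarrow> \<sigma> 1"
    using e by (auto simp: \<sigma>_def arcs_ends_def arc_to_ends_def)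
  let ?L = "\<lambda>n. {ys. set ys \<subseteq> verts T \<and> length ys = n}"
  let ?G = "\<lambda>ys. of_bool (cyclic_list T (tail T e # head T e # ys)) :: int"
  have "?L 6 \<inter> {ys. cyclic_list T (tail T e # head T e # ys)}
      = {ys. set ys \<subseteq> verts T \<and> length ys = 6 \<and> cyclic_list T (tail T e # head T e # ys)}"
    by auto
  then have "int (card {C \<in> cycle_subgraphs T 8. e \<in> arcs C}) = (\<Sum>ys\<in>?L 6. ?G ys)"
    using card_cycle_subgraphs_through_arc[OF e, of 6]
    by (simp add: sum_of_bool_eq finite_lists_length_eq)
  also have "\<dots> = (\<Sum>a\<in>verts T. \<Sum>b\<in>verts T. \<Sum>c\<in>verts T. \<Sum>d\<in>verts T. \<Sum>f\<in>verts T. \<Sum>g\<in>verts T.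
      ?G [a, b, c, d, f, g])"
    by (simp add: sum_lists_length_Suc numeral_eq_Suc del: sum_of_bool_eq cong: conj_cong)
  also have "\<dots> = sum_over [2, 3, 4, 5, 6, 7] (network_val cycle_network) \<sigma>"
    unfolding sum_over.simps
  proof (intro sum.cong refl)
    fix a b c d f g
    assume "a \<in> verts T" "b \<in> verts T" "c \<in> verts T" "d \<in> verts T" "f \<in> verts T" "g \<in> verts T"
    then have "range (\<sigma>(2 := a, 3 := b, 4 := c, 5 := d, 6 := f, 7 := g)) \<subseteq> verts T"
      using \<sigma>(1) by auto
    then show "?G [a, b, c, d, f, g]
        = network_val cycle_network (\<sigma>(2 := a, 3 := b, 4 := c, 5 := d, 6 := f, 7 := g))"
      by (simp add: network_val_cycle_network \<sigma>_def)
  qed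
  also have "\<dots> = pval [0, 0, 22, 8, -54, -8, 32]"
    by (intro evaluate_sound evaluate_cycle_network \<sigma>) auto
  also have "\<dots> = 2 * (int t + 1) * (int t - 1) * (int t)\<^sup>2 * (16 * (int t)\<^sup>2 - 4 * int t - 11)"
    by (simp add: power2_eq_square algebra_simps)
  finally show ?thesis .
qed

end

theorem theorem1:
  fixes T :: "('a, 'b) pre_digraph" and t :: nat
  assumes "doubly_regular_tournament T"
    and "card (verts T) = 4 * t + 3"
    and "e \<in> arcs T"
  shows "int (card {C \<in> cycle_subgraphs T 8. e \<in> arcs C}) =
    2 * (int t + 1) * (int t - 1) * (int t)\<^sup>2 * (16 * (int t)\<^sup>2 - 4 * int t - 11)"
proof -
  interpret doubly_regular_of_order T t
    using assms(1,2) by (simp add: doubly_regular_of_order_def doubly_regular_of_order_axioms_def)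
  show ?thesis using assms(3) by (rule card_8_cycles)
qed

end
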